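(* Let $\mathbb{F}$ be a field in which every quadratic and every cubic polynomial has a root, and let $\mathbb{A}$ be a two-dimensional algebra over $\mathbb{F}$ with basis $e_1,e_2$ and matrix of structure constants $A=\begin{pmatrix}\alpha_1&\alpha_2&\alpha_3&\alpha_4\\ \beta_1&\beta_2&\beta_3&\beta_4\end{pmatrix}$. Put $$p_A(y)=\alpha_4y^3+(\alpha_2+\alpha_3-\beta_4)y^2+(\alpha_1-\beta_2-\beta_3)y-\beta_1 .$$ Then the set of all nontrivial (that is, one-dimensional) subalgebras of $\mathbb{A}$ is - $\{\mathbb{F}(e_1+y_0e_2):\ y_0\in\mathbb{F},\ p_A(y_0)=0\}$ if $\alpha_4\neq0$; - $\{\mathbb{F}(e_1+y_0e_2):\ y_0\in\mathbb{F},\ p_A(y_0)=0\}\cup\{\mathbb{F}e_2\}$ if $\alpha_4=0$.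
   Context: An algebra is a vector space with a bilinear product (not necessarily associative, commutative or unital). The matrix of structure constants $A$ in the basis $e_1,e_2$ means $e_1e_1=\alpha_1e_1+\beta_1e_2$, $e_1e_2=\alpha_2e_1+\beta_2e_2$, $e_2e_1=\alpha_3e_1+\beta_3e_2$, $e_2e_2=\alpha_4e_1+\beta_4e_2$. *)

theory Defs
  imports "HOL-Analysis.Finite_Cartesian_Product" "HOL-Computational_Algebra.Polynomial"
begin

text \<open>The carrier of the vector space is the whole type. The product is only required to be
  bilinear.\<close>

locale nonassoc_algebra = vector_space scale
  for scale :: "'f::field \<Rightarrow> 'a::ab_group_add \<Rightarrow> 'a" +
  fixes mult :: "'a \<Rightarrow> 'a \<Rightarrow> 'a"
  assumes linear_mult_right: "\<And>x. Vector_Spaces.linear scale scale (\<lambda>y. mult x y)"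
    and linear_mult_left: "\<And>y. Vector_Spaces.linear scale scale (\<lambda>x. mult x y)"
begin

definition is_subalgebra :: "'a set \<Rightarrow> bool" where
  "is_subalgebra S \<longleftrightarrow> subspace S \<and> (\<forall>x\<in>S. \<forall>y\<in>S. mult x y \<in> S)"

text \<open>In a two-dimensional algebra the nontrivial subalgebras are the one-dimensional ones.\<close>

definition nontrivial_subalgebras :: "'a set set" where
  "nontrivial_subalgebras = {S. is_subalgebra S \<and> dim S = 1}"

definition is_basis2 :: "'a \<Rightarrow> 'a \<Rightarrow> bool" where
  "is_basis2 e1 e2 \<longleftrightarrow> e1 \<noteq> e2 \<and> independent {e1, e2} \<and> span {e1, e2} = UNIV"

text \<open>Row 1 of the matrix holds the coefficients $\alpha_1,\ldots,\alpha_4$ of \<open>e1\<close>, row 2 the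
  coefficients $\beta_1,\ldots,\beta_4$ of \<open>e2\<close>. In the index types \<open>2\<close> and \<open>4\<close> the largest
  index coincides with \<open>0\<close>, which does not clash with any other index in use.\<close>

definition has_structure_matrix :: "'a \<Rightarrow> 'a \<Rightarrow> 'f ^ 4 ^ 2 \<Rightarrow> bool" where
  "has_structure_matrix e1 e2 A \<longleftrightarrow>
     mult e1 e1 = scale (A $ 1 $ 1) e1 + scale (A $ 2 $ 1) e2 \<and>
     mult e1 e2 = scale (A $ 1 $ 2) e1 + scale (A $ 2 $ 2) e2 \<and>
     mult e2 e1 = scale (A $ 1 $ 3) e1 + scale (A $ 2 $ 3) e2 \<and>
     mult e2 e2 = scale (A $ 1 $ 4) e1 + scale (A $ 2 $ 4) e2"

definition line :: "'a \<Rightarrow> 'a set" where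
  "line v = {scale c v | c. True}"

end

definition subalgebra_poly :: "'f::field ^ 4 ^ 2 \<Rightarrow> 'f poly" where
  "subalgebra_poly A =
     monom (A $ 1 $ 4) 3 +
     monom (A $ 1 $ 2 + A $ 1 $ 3 - A $ 2 $ 4) 2 +
     monom (A $ 1 $ 1 - A $ 2 $ 2 - A $ 2 $ 3) 1 -
     [:A $ 2 $ 1:]"

end

theory Submission
  imports Defs
begin

text \<open>A line is closed under the product iff it contains the square of a generator. Comparing
  the coordinates of \<open>(e1 + y e2)\<^sup>2\<close> with those of a multiple of \<open>e1 + y e2\<close>, the obstruction
  is exactly \<open>p\<^sub>A(y)\<close>; the only line not of this form is spanned by \<open>e2\<close>, whose square has
  \<open>e1\<close>-coordinate \<open>\<alpha>\<^sub>4\<close>.\<close>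

lemma poly_subalgebra_poly:
  "poly (subalgebra_poly A) y =
     A $ 1 $ 4 * y ^ 3 + (A $ 1 $ 2 + A $ 1 $ 3 - A $ 2 $ 4) * y\<^sup>2
     + (A $ 1 $ 1 - A $ 2 $ 2 - A $ 2 $ 3) * y - A $ 2 $ 1"
  by (simp add: subalgebra_poly_def poly_monom)

context nonassoc_algebra
begin

lemma mult_add_right: "mult x (y + z) = mult x y + mult x z"
  by (rule module_hom.add[OF Vector_Spaces.linear.axioms(3)[OF linear_mult_right]])

lemma mult_add_left: "mult (x + y) z = mult x z + mult y z"
  by (rule module_hom.add[OF Vector_Spaces.linear.axioms(3)[OF linear_mult_left]])

lemma mult_scale_right: "mult x (scale c y) = scale c (mult x y)"
  by (rule module_hom.scale[OF Vector_Spaces.linear.axioms(3)[OF linear_mult_right]])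

lemma mult_scale_left: "mult (scale c x) y = scale c (mult x y)"
  by (rule module_hom.scale[OF Vector_Spaces.linear.axioms(3)[OF linear_mult_left]])

lemmas mult_simps = mult_add_right mult_add_left mult_scale_right mult_scale_left

lemma line_eq_span: "line v = span {v}"
  by (auto simp: line_def span_singleton)

lemma mem_line: "x \<in> line v \<longleftrightarrow> (\<exists>c. x = scale c v)"
  by (auto simp: line_def)

lemma line_scale:
  assumes "c \<noteq> 0"
  shows "line (scale c v) = line v"
proof (intro equalityI subsetI)
  fix x assume "x \<in> line v"
  then obtain d where "x = scale d v" by (auto simp: mem_line)
  then have "x = scale (d / c) (scale c v)" using assms by simp
  then show "x \<in> line (scale c v)" unfolding mem_line by blast
qed (auto simp: mem_line)

text \<open>By bilinearity the product of \<open>scale c v\<close> and \<open>scale d v\<close> is a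
  multiple of \<open>mult v v\<close>, so closure needs checking only at the generator.\<close>

lemma is_subalgebra_line: "is_subalgebra (line v) \<longleftrightarrow> mult v v \<in> line v"
proof
  assume "is_subalgebra (line v)"
  moreover have "v \<in> line v" by (simp add: line_eq_span span_base)
  ultimately show "mult v v \<in> line v" by (simp add: is_subalgebra_def)
next
  assume "mult v v \<in> line v"
  then have "mult x y \<in> line v" if "x \<in> line v" "y \<in> line v" for x y
    using that by (auto simp: line_eq_span span_singleton mult_simps)
  then show "is_subalgebra (line v)"
    by (simp add: is_subalgebra_def line_eq_span)
qed

text \<open>Replaces the search over subspaces by a search over nonzero generators, each tested by
  its own square.\<close>

lemma nontrivial_subalgebras_eq:
  "nontrivial_subalgebras = {line v | v. v \<noteq> 0 \<and> mult v v \<in> line v}"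
proof (intro equalityI subsetI)
  fix S assume "S \<in> nontrivial_subalgebras"
  then have S: "is_subalgebra S" "subspace S" "dim S = 1"
    by (auto simp: nontrivial_subalgebras_def is_subalgebra_def)
  obtain B where B: "B \<subseteq> S" "independent B" "S \<subseteq> span B" "card B = dim S"
    using basis_exists by blast
  \<comment> \<open>\<open>card\<close> is 0 on infinite sets, so cardinality 1 really forces a
    singleton.\<close>
  then obtain v where v: "B = {v}" using S(3) by (metis card_1_singletonE)
  have "S = line v"
    using B v span_minimal[OF B(1) S(2)] by (simp add: line_eq_span subset_antisym)
  moreover have "v \<noteq> 0" using B(2) v dependent_zero by blast
  ultimately show "S \<in> {line v | v. v \<noteq> 0 \<and> mult v v \<in> line v}"
    using S(1) is_subalgebra_line by blast
next
  fix S assume "S \<in> {line v | v. v \<noteq> 0 \<and> mult v v \<in> line v}"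
  then obtain v where v: "S = line v" "v \<noteq> 0" "mult v v \<in> line v" by blast
  \<comment> \<open>Since \<open>v\<close> is nonzero, \<open>{v}\<close> is independent and hence a
    basis of its span.\<close>
  have "dim (line v) = 1"
    using v(2) by (simp add: line_eq_span dim_eq_card_independent)
  then show "S \<in> nontrivial_subalgebras"
    using v by (simp add: nontrivial_subalgebras_def is_subalgebra_line)
qed

lemma basis2_coordinates:
  assumes "is_basis2 e1 e2"
  obtains a b where "v = scale a e1 + scale b e2"
proof -
  have "v \<in> span {e1, e2}" using assms by (simp add: is_basis2_def)
  then obtain a where "v - scale a e1 \<in> span {e2}" by (auto simp: span_insert)
  then obtain b where "v - scale a e1 = scale b e2" by (auto simp: span_singleton)
  then have "v = scale a e1 + scale b e2" by (simp add: algebra_simps)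
  then show thesis by (rule that)
qed

lemma basis2_eq_iff:
  assumes "is_basis2 e1 e2"
  shows "scale a e1 + scale b e2 = scale c e1 + scale d e2 \<longleftrightarrow> a = c \<and> b = d"
proof
  assume eq: "scale a e1 + scale b e2 = scale c e1 + scale d e2"
  have ind: "independent {e1, e2}" "e1 \<noteq> e2" using assms by (auto simp: is_basis2_def)
  \<comment> \<open>Coefficients of the difference of the two sides; as \<open>e1\<close> and
    \<open>e2\<close> differ, the value at \<open>e2\<close> is \<open>b - d\<close>.\<close>
  let ?u = "\<lambda>v. if v = e1 then a - c else b - d"
  have "(\<Sum>v\<in>{e1, e2}. scale (?u v) v) = 0"
    using eq ind(2) by (simp add: algebra_simps)
  then have "?u v = 0" if "v \<in> {e1, e2}" for v
    by (rule independentD[OF ind(1) _ subset_refl _ that, where u = ?u, rotated]) simp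
  from this[of e1] this[of e2] show "a = c \<and> b = d" using ind(2) by auto
qed simp

lemma basis2_nonzero:
  assumes "is_basis2 e1 e2"
  shows "e1 + scale y e2 \<noteq> 0" "e2 \<noteq> 0"
  using basis2_eq_iff[OF assms, of 1 y 0 0] basis2_eq_iff[OF assms, of 0 1 0 0] by auto

text \<open>Rescaling a generator keeps its line, so a nonzero \<open>e1\<close>-coordinate can be
  normalized to 1; the slope is then \<open>y = b / a\<close>.\<close>

lemma lines_basis2:
  assumes "is_basis2 e1 e2" and "v \<noteq> 0"
  shows "(\<exists>y. line v = line (e1 + scale y e2)) \<or> line v = line e2"
proof -
  obtain a b where v: "v = scale a e1 + scale b e2"
    using basis2_coordinates[OF assms(1)] .
  show ?thesis
  proof (cases "a = 0")
    case True
    \<comment> \<open>Here \<open>v = scale b e2\<close>, and \<open>b\<close> is nonzero because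
      \<open>v\<close> is.\<close>
    then show ?thesis using v assms(2) line_scale[of b e2] by auto
  next
    case False
    then have "v = scale a (e1 + scale (b / a) e2)"
      using v by (simp add: scale_right_distrib)
    then show ?thesis using line_scale[OF False] by blast
  qed
qed

lemma square_mem_line_iff:
  assumes "is_basis2 e1 e2" and "has_structure_matrix e1 e2 A"
  shows "mult (e1 + scale y e2) (e1 + scale y e2) \<in> line (e1 + scale y e2)
    \<longleftrightarrow> poly (subalgebra_poly A) y = 0"
proof -
  \<comment> \<open>\<open>?a\<close> and \<open>?b\<close> are the coordinates of the square,
    obtained by bilinear expansion.\<close>
  let ?a = "A $ 1 $ 1 + y * (A $ 1 $ 2 + A $ 1 $ 3) + y\<^sup>2 * A $ 1 $ 4"
  let ?b = "A $ 2 $ 1 + y * (A $ 2 $ 2 + A $ 2 $ 3) + y\<^sup>2 * A $ 2 $ 4"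
  have "mult (e1 + scale y e2) (e1 + scale y e2) = scale ?a e1 + scale ?b e2"
    using assms(2)
    by (simp add: has_structure_matrix_def mult_simps scale_right_distrib scale_left_distrib
        power2_eq_square algebra_simps)
  moreover have "scale c (e1 + scale y e2) = scale c e1 + scale (c * y) e2" for c
    by (simp add: scale_right_distrib)
  \<comment> \<open>The generator has \<open>e1\<close>-coordinate 1, so the factor \<open>c\<close>
    can only be \<open>?a\<close>; what remains is the equation for the
    \<open>e2\<close>-coordinate.\<close>
  ultimately have "mult (e1 + scale y e2) (e1 + scale y e2) \<in> line (e1 + scale y e2)
      \<longleftrightarrow> ?b = ?a * y"
    by (auto simp: mem_line basis2_eq_iff[OF assms(1)])
  also have "\<dots> \<longleftrightarrow> ?a * y - ?b = 0" by auto
  also have "?a * y - ?b = poly (subalgebra_poly A) y"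
    by (simp add: poly_subalgebra_poly power2_eq_square power3_eq_cube algebra_simps)
  finally show ?thesis .
qed

lemma square_mem_line_e2_iff:
  assumes "is_basis2 e1 e2" and "has_structure_matrix e1 e2 A"
  shows "mult e2 e2 \<in> line e2 \<longleftrightarrow> A $ 1 $ 4 = 0"
proof -
  \<comment> \<open>The factor \<open>c\<close> is free, so \<beta>_4 can always be matched and only
    \<alpha>_4 obstructs.\<close>
  have "mult e2 e2 = scale c e2 \<longleftrightarrow> A $ 1 $ 4 = 0 \<and> A $ 2 $ 4 = c" for c
    using assms(2) basis2_eq_iff[OF assms(1), of "A $ 1 $ 4" "A $ 2 $ 4" 0 c]
    by (simp add: has_structure_matrix_def)
  then show ?thesis by (auto simp: mem_line)
qed

text \<open>Every one-dimensional subalgebra is one of the lines in \<open>lines_basis2\<close>, and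
  the two square criteria decide which of these lines qualify.\<close>

lemma nontrivial_subalgebras_basis2:
  assumes "is_basis2 e1 e2" and "has_structure_matrix e1 e2 A"
  shows "nontrivial_subalgebras =
    {line (e1 + scale y e2) | y. poly (subalgebra_poly A) y = 0}
    \<union> (if A $ 1 $ 4 = 0 then {line e2} else {})" (is "_ = ?R")
proof (intro equalityI subsetI)
  fix S assume S: "S \<in> nontrivial_subalgebras"
  then obtain v where "S = line v" "v \<noteq> 0" by (auto simp: nontrivial_subalgebras_eq)
  then consider y where "S = line (e1 + scale y e2)" | "S = line e2"
    using lines_basis2[OF assms(1)] by blast
  moreover have "is_subalgebra S" using S by (simp add: nontrivial_subalgebras_def)
  ultimately show "S \<in> ?R"
    by cases (auto simp: is_subalgebra_line square_mem_line_iff[OF assms]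
        square_mem_line_e2_iff[OF assms])
next
  fix S assume "S \<in> ?R"
  \<comment> \<open>The listed generators are nonzero by \<open>basis2_nonzero\<close>, so their
    lines do have dimension 1.\<close>
  then show "S \<in> nontrivial_subalgebras"
    using square_mem_line_iff[OF assms] square_mem_line_e2_iff[OF assms]
      basis2_nonzero[OF assms(1)]
    unfolding nontrivial_subalgebras_eq by (auto split: if_splits)
qed

end

theorem proposition3p1:
  fixes scale :: "'f::field \<Rightarrow> 'a::ab_group_add \<Rightarrow> 'a"
    and mult :: "'a \<Rightarrow> 'a \<Rightarrow> 'a"
    and e1 e2 :: 'a
    and A :: "'f ^ 4 ^ 2"
  assumes roots: "\<forall>p :: 'f poly. degree p = 2 \<or> degree p = 3 \<longrightarrow> (\<exists>x. poly p x = 0)"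
    and algebra: "nonassoc_algebra scale mult"
    and basis: "nonassoc_algebra.is_basis2 scale e1 e2"
    and matrix: "nonassoc_algebra.has_structure_matrix scale mult e1 e2 A"
  shows "(A $ 1 $ 4 \<noteq> 0 \<longrightarrow>
            nonassoc_algebra.nontrivial_subalgebras scale mult =
              {nonassoc_algebra.line scale (e1 + scale y0 e2) | y0. poly (subalgebra_poly A) y0 = 0})
       \<and> (A $ 1 $ 4 = 0 \<longrightarrow>
            nonassoc_algebra.nontrivial_subalgebras scale mult =
              {nonassoc_algebra.line scale (e1 + scale y0 e2) | y0. poly (subalgebra_poly A) y0 = 0}
              \<union> {nonassoc_algebra.line scale e2})"
  \<comment> \<open>The two cases are the branches of the conditional on \<alpha>_4.\<close>
  using nonassoc_algebra.nontrivial_subalgebras_basis2[OF algebra basis matrix] by simp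

end
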